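(* Let $k=4$ and $r_1\ge r_2\ge r_3\ge r_4\ge 1$. If $(r_2-1)+(r_3-1)-(r_4-1)\le (r_1-1)< (r_2-1)+(r_3-1)+(r_4-1)$, then the arithmetic mean component competitive ratio for the 4-objective time series search problem is $$z_f^4=\frac18\left[\sqrt{4r_4+\{(r_1-1)-(r_2-1)-(r_3-1)\}^2}+(r_1+1)+(r_2+1)+(r_3+1)\right].$$
   Context: For an integer $k\ge 2$ and reals $0<m_i\le M_i$ ($1\le i\le k$), let $r_i=M_i/m_i$ be the fluctuation ratio of the price interval $[m_i,M_i]$ of the $i$th objective. It is assumed throughout that $r_1\ge\cdots\ge r_k\ge 1$. The arithmetic mean component competitive ratio of the $k$-objective time series search problem is the quantity $$z_f^k=\sup_{(x_1,\ldots,x_k)\in\mathcal{S}_f^k}\frac1k\left(\frac{M_1}{x_1}+\cdots+\frac{M_k}{x_k}\right),$$ where $$\mathcal{S}_f^k=\left\{(x_1,\ldots,x_k)\in[m_1,M_1]\times\cdots\times[m_k,M_k] : \frac1k\sum_{i=1}^k\frac{x_i}{m_i}=\frac1k\sum_{i=1}^k\frac{M_i}{x_i}\right\}.$$ *)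

theory Defs
  imports Complex_Main "HOL-Library.FuncSet"
begin

text \<open>The price interval of the \<open>i\<close>th objective is \<open>[m i, M i]\<close> for \<open>1 \<le> i \<le> k\<close>; values of
  \<open>m\<close> and \<open>M\<close> at other indices are irrelevant. A \<open>k\<close>-tuple is an extensional function on
  \<open>{1..k}\<close>.\<close>

definition fluctuation_ratio :: "(nat \<Rightarrow> real) \<Rightarrow> (nat \<Rightarrow> real) \<Rightarrow> nat \<Rightarrow> real" where
  "fluctuation_ratio m M i = M i / m i"

definition S_f :: "nat \<Rightarrow> (nat \<Rightarrow> real) \<Rightarrow> (nat \<Rightarrow> real) \<Rightarrow> (nat \<Rightarrow> real) set" where
  "S_f k m M =
     {x \<in> (\<Pi>\<^sub>E i\<in>{1..k}. {m i..M i}).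
        1 / real k * (\<Sum>i=1..k. x i / m i) = 1 / real k * (\<Sum>i=1..k. M i / x i)}"

text \<open>For \<open>k \<ge> 1\<close> and \<open>0 < m i \<le> M i\<close> the supremum is taken over a nonempty set (it contains the
  value at \<open>x i = sqrt (m i * M i)\<close>) that is bounded above (\<open>M i / x i \<le> M i / m i\<close>), so the
  conditionally complete \<open>Sup\<close> on the reals is the genuine supremum.\<close>

definition z_f :: "nat \<Rightarrow> (nat \<Rightarrow> real) \<Rightarrow> (nat \<Rightarrow> real) \<Rightarrow> real" where
  "z_f k m M = (SUP x\<in>S_f k m M. 1 / real k * (\<Sum>i=1..k. M i / x i))"

end

theory Submission imports Defs begin

text \<open>Write \<open>y i = x i / m i \<in> [1, r i]\<close>, \<open>s i = r i - 1\<close> and \<open>t i = y i - r i / y i \<in> [- s i, s i]\<close>.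
  Then \<open>S_f\<close> is cut out by \<open>\<Sum>t i = 0\<close>, on which the objective is
  \<open>1/8 * \<Sum>sqrt ((t i)\<^sup>2 + 4 * r i)\<close>. Each summand is at most \<open>r i + 1\<close>, with equality at
  \<open>t i = \<plusminus> s i\<close>; the loss at distance \<open>w i = s i - \<bar>t i\<bar>\<close> from these ends is
  \<open>deficit (s i) (w i)\<close>, which is increasing in \<open>s i\<close> and, on \<open>[0, s i]\<close>, increasing and
  subadditive in \<open>w i\<close>. Hence the total loss is at least that of concentrating \<open>\<Sum>w i\<close> on the
  fourth objective. With \<open>u = s 1 - s 2 - s 3\<close>, the constraint \<open>\<Sum>t i = 0\<close> forces
  \<open>\<Sum>w i \<ge> s 4 - \<bar>u\<bar>\<close>, and equality holds for \<open>t = (s 1, - s 2, - s 3, - u)\<close>.\<close>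

definition deficit :: "real \<Rightarrow> real \<Rightarrow> real" where
  "deficit s w = s + 2 - sqrt ((s - w)\<^sup>2 + 4 * (s + 1))"

text \<open>Triangle inequality in the plane for the vectors \<open>l * (y, sqrt c)\<close> and
  \<open>n * (z, sqrt c)\<close>; unnormalised weights avoid division.\<close>

lemma sqrt_square_plus_convex:
  fixes x y z c l n :: real
  assumes "0 \<le> l" "0 \<le> n" "0 \<le> c" and eq: "(l + n) * x = l * y + n * z"
  shows "(l + n) * sqrt (x\<^sup>2 + c) \<le> l * sqrt (y\<^sup>2 + c) + n * sqrt (z\<^sup>2 + c)"
proof -
  have scale: "a * sqrt (v\<^sup>2 + c) = sqrt ((a * v)\<^sup>2 + (a * sqrt c)\<^sup>2)" if "0 \<le> a" for a v :: real
  proof -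
    have "(a * v)\<^sup>2 + (a * sqrt c)\<^sup>2 = a\<^sup>2 * (v\<^sup>2 + c)"
      using \<open>0 \<le> c\<close> by (simp add: power_mult_distrib distrib_left)
    then show ?thesis using that by (simp add: real_sqrt_mult)
  qed
  have "(l + n) * sqrt (x\<^sup>2 + c) = sqrt ((l * y + n * z)\<^sup>2 + (l * sqrt c + n * sqrt c)\<^sup>2)"
    using assms scale[of "l + n" x] by (simp add: distrib_right)
  also have "\<dots> \<le> l * sqrt (y\<^sup>2 + c) + n * sqrt (z\<^sup>2 + c)"
    unfolding scale[OF \<open>0 \<le> l\<close>] scale[OF \<open>0 \<le> n\<close>] by (rule real_sqrt_sum_squares_triangle_ineq)
  finally show ?thesis .
qed

lemma deficit_mono_ratio:
  assumes "s' \<le> s" "0 \<le> w"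
  shows "deficit s' w \<le> deficit s w"
proof -
  \<comment> \<open>In terms of \<open>p = s + 2 - w\<close> the deficit is \<open>w + (p - sqrt (p\<^sup>2 + 4 * w))\<close>.\<close>
  have form: "deficit v w = v + 2 - sqrt ((v + 2 - w)\<^sup>2 + (2 * sqrt w)\<^sup>2)" for v
    using \<open>0 \<le> w\<close> by (simp add: deficit_def power2_eq_square algebra_simps)
  \<comment> \<open>Adding the vector \<open>(s - s', 0)\<close> lengthens
    \<open>(s' + 2 - w, 2 * sqrt w)\<close> by at most \<open>s - s'\<close>.\<close>
  have "sqrt (((s' + 2 - w) + (s - s'))\<^sup>2 + (2 * sqrt w + 0)\<^sup>2)
      \<le> sqrt ((s' + 2 - w)\<^sup>2 + (2 * sqrt w)\<^sup>2) + sqrt ((s - s')\<^sup>2 + 0\<^sup>2)"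
    by (rule real_sqrt_sum_squares_triangle_ineq)
  moreover have "(s' + 2 - w) + (s - s') = s + 2 - w" by simp
  ultimately show ?thesis using assms by (simp add: form)
qed

lemma deficit_mono:
  assumes "w \<le> w'" "w' \<le> s"
  shows "deficit s w \<le> deficit s w'"
proof -
  have "(s - w')\<^sup>2 \<le> (s - w)\<^sup>2" using assms by (intro power_mono) auto
  then show ?thesis by (simp add: deficit_def)
qed

lemma deficit_zero: "- 2 \<le> s \<Longrightarrow> deficit s 0 = 0"
proof -
  assume "- 2 \<le> s"
  moreover have "(s - 0)\<^sup>2 + 4 * (s + 1) = (s + 2)\<^sup>2" by (simp add: power2_eq_square algebra_simps)
  ultimately show ?thesis by (simp add: deficit_def)
qed

text \<open>Concavity in \<open>w\<close> together with the value 0 at 0: both \<open>s - a\<close>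
  and \<open>s - b\<close> are averages of \<open>s\<close> and \<open>s - (a + b)\<close>, with the
  weights swapped.\<close>

lemma deficit_subadditive:
  assumes "0 \<le> a" "0 \<le> b" "0 \<le> s"
  shows "deficit s (a + b) \<le> deficit s a + deficit s b"
proof (cases "a + b = 0")
  case True
  with assms show ?thesis using deficit_zero[of s] by (simp add: add_nonneg_eq_0_iff)
next
  case False
  define g where "g x = sqrt (x\<^sup>2 + 4 * (s + 1))" for x
  have g_s: "g s = s + 2"
    using deficit_zero[of s] assms by (simp add: deficit_def g_def)
  have "(b + a) * g (s - a) \<le> b * g s + a * g (s - (a + b))"
    "(a + b) * g (s - b) \<le> a * g s + b * g (s - (a + b))"
    unfolding g_def using assms by (intro sqrt_square_plus_convex; simp add: algebra_simps)+
  then have "(a + b) * (g (s - a) + g (s - b)) \<le> (a + b) * (g s + g (s - (a + b)))"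
    by (simp add: algebra_simps)
  then have "g (s - a) + g (s - b) \<le> g s + g (s - (a + b))"
    using False assms by (simp add: mult_le_cancel_left)
  then show ?thesis using g_s by (simp add: deficit_def g_def)
qed

text \<open>Since \<open>deficit s\<close> increases only up to \<open>s\<close>, arguments are
  capped there, so that sums of several distances may exceed \<open>s\<close>.\<close>

lemma deficit_min_subadditive:
  assumes "0 \<le> a" "0 \<le> b" "0 \<le> s"
  shows "deficit s (min (a + b) s) \<le> deficit s (min a s) + deficit s (min b s)"
proof -
  define b' where "b' = min (a + b) s - min a s"
  have b': "0 \<le> b'" "b' \<le> min b s" using assms by (auto simp: b'_def min_def)
  have "deficit s (min (a + b) s) = deficit s (min a s + b')" by (simp add: b'_def)
  also have "\<dots> \<le> deficit s (min a s) + deficit s b'"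
    using assms b' by (intro deficit_subadditive) auto
  also have "deficit s b' \<le> deficit s (min b s)" using b' by (intro deficit_mono) auto
  finally show ?thesis by simp
qed

lemma deficit_ge_min:
  assumes "s' \<le> s" "0 \<le> w" "w \<le> s" "0 \<le> s'"
  shows "deficit s' (min w s') \<le> deficit s w"
  using deficit_mono_ratio[of s' s "min w s'"] deficit_mono[of "min w s'" w s] assms by linarith

lemma sum_sqrt_le:
  fixes s1 s2 s3 s4 t1 t2 t3 t4 :: real
  assumes ord: "s2 \<le> s1" "s3 \<le> s2" "s4 \<le> s3" "0 \<le> s4"
    and bds: "\<bar>t1\<bar> \<le> s1" "\<bar>t2\<bar> \<le> s2" "\<bar>t3\<bar> \<le> s3" "\<bar>t4\<bar> \<le> s4"
    and sum0: "t1 + t2 + t3 + t4 = 0"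
  shows "sqrt (t1\<^sup>2 + 4 * (s1 + 1)) + sqrt (t2\<^sup>2 + 4 * (s2 + 1))
       + sqrt (t3\<^sup>2 + 4 * (s3 + 1)) + sqrt (t4\<^sup>2 + 4 * (s4 + 1))
     \<le> sqrt ((s1 - s2 - s3)\<^sup>2 + 4 * (s4 + 1)) + (s1 + 2) + (s2 + 2) + (s3 + 2)"
proof -
  define u where "u = s1 - s2 - s3"
  define h where "h w = deficit s4 (min w s4)" for w
  let ?w1 = "s1 - \<bar>t1\<bar>" and ?w2 = "s2 - \<bar>t2\<bar>" and ?w3 = "s3 - \<bar>t3\<bar>" and ?w4 = "s4 - \<bar>t4\<bar>"
  have sqrt_eq: "sqrt (t\<^sup>2 + 4 * (s + 1)) = s + 2 - deficit s (s - \<bar>t\<bar>)" for s t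
    by (simp add: deficit_def)
  \<comment> \<open>The positive and the negative \<open>t\<close>s have the same absolute total.
    One of these sign classes contains only the first index or at most two of the others, so this
    total is at most \<open>max s1 (s2 + s3)\<close>, and twice that maximum is
    \<open>s1 + s2 + s3 + \<bar>u\<bar>\<close>.\<close>
  have "s4 - \<bar>u\<bar> \<le> ?w1 + ?w2 + ?w3 + ?w4"
    using ord bds sum0 unfolding u_def by linarith
  then have "deficit s4 (s4 - \<bar>u\<bar>) \<le> h (?w1 + ?w2 + ?w3 + ?w4)"
    unfolding h_def by (intro deficit_mono) auto
  also have "\<dots> \<le> h (?w1 + ?w2 + ?w3) + h ?w4"
    unfolding h_def using ord bds by (intro deficit_min_subadditive) auto
  also have "h (?w1 + ?w2 + ?w3) \<le> h (?w1 + ?w2) + h ?w3"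
    unfolding h_def using ord bds by (intro deficit_min_subadditive) auto
  also have "h (?w1 + ?w2) \<le> h ?w1 + h ?w2"
    unfolding h_def using ord bds by (intro deficit_min_subadditive) auto
  finally have "deficit s4 (s4 - \<bar>u\<bar>) \<le> h ?w1 + h ?w2 + h ?w3 + h ?w4" by simp
  moreover have "h ?w1 \<le> deficit s1 ?w1" "h ?w2 \<le> deficit s2 ?w2"
    "h ?w3 \<le> deficit s3 ?w3" "h ?w4 \<le> deficit s4 ?w4"
    unfolding h_def using ord bds by (intro deficit_ge_min; simp)+
  ultimately show ?thesis
    unfolding sqrt_eq u_def[symmetric] by linarith
qed

lemma sqrt_diff_ratio:
  fixes y r :: real
  assumes "0 < y" "0 \<le> r"
  shows "sqrt ((y - r / y)\<^sup>2 + 4 * r) = y + r / y"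
proof -
  have "(y - r / y)\<^sup>2 + 4 * r = (y + r / y)\<^sup>2"
    using assms by (simp add: power2_eq_square field_simps)
  then show ?thesis using assms by simp
qed

lemma abs_diff_ratio_le:
  fixes y r :: real
  assumes "1 \<le> y" "y \<le> r"
  shows "\<bar>y - r / y\<bar> \<le> r - 1"
proof -
  have "1 \<le> r / y" "r / y \<le> r" using assms by (auto simp: field_simps)
  with assms show ?thesis by linarith
qed

lemma exists_diff_ratio:
  fixes r t :: real
  assumes "1 \<le> r" "\<bar>t\<bar> \<le> r - 1"
  obtains y where "1 \<le> y" "y \<le> r" "y - r / y = t"
    and "y + r / y = sqrt (t\<^sup>2 + 4 * r)"
proof -
  define q where "q = sqrt (t\<^sup>2 + 4 * r)"
  \<comment> \<open>The positive root of \<open>y\<^sup>2 - t * y - r = 0\<close>; the other root is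
    \<open>- r / y\<close>.\<close>
  define y where "y = (q + t) / 2"
  have q2: "q\<^sup>2 = t\<^sup>2 + 4 * r" using assms by (simp add: q_def)
  have sq: "t\<^sup>2 \<le> (r - 1)\<^sup>2" using assms by (simp add: abs_le_square_iff[symmetric])
  have q_le: "q \<le> r + 1" unfolding q_def
    using sq assms by (intro real_le_lsqrt) (auto simp: power2_eq_square algebra_simps)
  \<comment> \<open>After squaring, this is \<open>1 - t \<le> r\<close>.\<close>
  have "2 - t \<le> q" unfolding q_def
    using assms by (intro real_le_rsqrt) (auto simp: power2_eq_square algebra_simps)
  then have "1 \<le> y" by (simp add: y_def)
  have "y \<le> r" using q_le assms by (simp add: y_def)
  have "y * ((q - t) / 2) = r"
    using q2 by (simp add: y_def power2_eq_square algebra_simps)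
  then have "r / y = (q - t) / 2" using \<open>1 \<le> y\<close> by (simp add: field_simps)
  then have "y - r / y = t" "y + r / y = q" by (auto simp: y_def field_simps)
  with \<open>1 \<le> y\<close> \<open>y \<le> r\<close> show ?thesis using that q_def by blast
qed

lemma sum_1_to_4: "(\<Sum>i=1..4. f i) = f 1 + f 2 + f 3 + f (4::nat)" for f :: "nat \<Rightarrow> real"
  by (simp add: numeral_eq_Suc)

theorem theorem6p2:
  fixes m M r :: "nat \<Rightarrow> real"
  assumes "\<And>i. i \<in> {1..4} \<Longrightarrow> 0 < m i \<and> m i \<le> M i"
    and "\<And>i. i \<in> {1..4} \<Longrightarrow> r i = fluctuation_ratio m M i"
    and "r 1 \<ge> r 2" and "r 2 \<ge> r 3" and "r 3 \<ge> r 4" and "r 4 \<ge> 1"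
    and "(r 2 - 1) + (r 3 - 1) - (r 4 - 1) \<le> r 1 - 1"
    and "r 1 - 1 < (r 2 - 1) + (r 3 - 1) + (r 4 - 1)"
  shows "z_f 4 m M =
    1 / 8 * (sqrt (4 * r 4 + ((r 1 - 1) - (r 2 - 1) - (r 3 - 1))\<^sup>2)
             + (r 1 + 1) + (r 2 + 1) + (r 3 + 1))"
    (is "_ = ?Z")
proof -
  let ?I = "{1..4::nat}"
  let ?u = "(r 1 - 1) - (r 2 - 1) - (r 3 - 1)"
  have mpos: "0 < m i" and M_eq: "M i = r i * m i" if "i \<in> ?I" for i
    using assms(1)[OF that] assms(2)[OF that] by (auto simp: fluctuation_ratio_def)
  \<comment> \<open>The two bounds on \<open>r 1 - 1\<close> are what allows the fourth objective to
    balance the other three, whose \<open>t\<close>s will add up to \<open>?u\<close>.\<close>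
  have "\<bar>- ?u\<bar> \<le> r 4 - 1" using assms(7,8) by linarith
  then obtain y4 where y4: "1 \<le> y4" "y4 \<le> r 4" "y4 - r 4 / y4 = - ?u"
      "y4 + r 4 / y4 = sqrt ((- ?u)\<^sup>2 + 4 * r 4)"
    using exists_diff_ratio assms(6) by blast
  \<comment> \<open>The maximiser: the first price is at its upper end, the second and third are at
    their lower ends, and the fourth restores the constraint.\<close>
  define y where "y = (\<lambda>i::nat. 1::real)(1 := r 1, 4 := y4)"
  define x where "x = restrict (\<lambda>i. m i * y i) ?I"
  have y_bds: "1 \<le> y i" "y i \<le> r i" if "i \<in> ?I" for i
  proof -
    have "i = 1 \<or> i = 2 \<or> i = 3 \<or> i = 4" using that by auto
    then show "1 \<le> y i" "y i \<le> r i" using assms(3-6) y4(1,2) by (auto simp: y_def)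
  qed
  have x_ratio: "x i / m i = y i" "M i / x i = r i / y i" if "i \<in> ?I" for i
    using that mpos[OF that] M_eq[OF that] by (auto simp: x_def)
  have sum_x: "(\<Sum>i=1..4. x i / m i) = r 1 + 1 + 1 + y4"
    "(\<Sum>i=1..4. M i / x i) = 1 + r 2 + r 3 + r 4 / y4"
    using assms(3-6) unfolding sum_1_to_4 by (simp_all add: x_ratio y_def)
  have x_mem: "x \<in> S_f 4 m M"
  proof -
    have "x i \<in> {m i..M i}" if "i \<in> ?I" for i
      using that mpos[OF that] M_eq[OF that] y_bds[OF that] by (auto simp: x_def mult.commute)
    then have "x \<in> (\<Pi>\<^sub>E i\<in>?I. {m i..M i})" by (auto simp: x_def)
    moreover have "(\<Sum>i=1..4. x i / m i) = (\<Sum>i=1..4. M i / x i)"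
      using y4(3) unfolding sum_x by simp
    ultimately show ?thesis by (simp add: S_f_def)
  qed
  have x_val: "1 / real 4 * (\<Sum>i=1..4. M i / x i) = ?Z"
  proof -
    have sqrt_u: "sqrt (4 * r 4 + ?u\<^sup>2) = y4 + r 4 / y4"
      using y4(4) by (simp only: power2_minus add.commute)
    show ?thesis using y4(3) unfolding sum_x sqrt_u of_nat_numeral by argo
  qed
  have upper: "1 / real 4 * (\<Sum>i=1..4. M i / v i) \<le> ?Z" if "v \<in> S_f 4 m M" for v
  proof -
    define w where "w i = v i / m i" for i
    define t where "t i = w i - r i / w i" for i
    have v_mem: "v i \<in> {m i..M i}" if "i \<in> ?I" for i
      using \<open>v \<in> S_f 4 m M\<close> that by (auto simp: S_f_def)
    have eq: "(\<Sum>i=1..4. v i / m i) = (\<Sum>i=1..4. M i / v i)"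
      using that by (simp add: S_f_def)
    have w_bds: "1 \<le> w i" "w i \<le> r i" and M_v: "M i / v i = r i / w i" if "i \<in> ?I" for i
      using v_mem[OF that] mpos[OF that] M_eq[OF that] by (auto simp: w_def field_simps)
    have t_bds: "\<bar>t i\<bar> \<le> r i - 1" if "i \<in> ?I" for i
      unfolding t_def using w_bds[OF that] by (rule abs_diff_ratio_le)
    have sqrt_t: "sqrt ((t i)\<^sup>2 + 4 * (r i - 1 + 1)) = w i + r i / w i" if "i \<in> ?I" for i
      using sqrt_diff_ratio[of "w i" "r i"] w_bds[OF that] by (simp add: t_def)
    have sums: "(\<Sum>i=1..4. M i / v i) = r 1 / w 1 + r 2 / w 2 + r 3 / w 3 + r 4 / w 4"
      unfolding sum_1_to_4 by (simp add: M_v)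
    have eq_w: "w 1 + w 2 + w 3 + w 4 = r 1 / w 1 + r 2 / w 2 + r 3 / w 3 + r 4 / w 4"
      using eq unfolding sums unfolding sum_1_to_4 by (simp add: w_def)
    have in_I: "1 \<in> ?I" "2 \<in> ?I" "3 \<in> ?I" "4 \<in> ?I" by auto
    have "t 1 + t 2 + t 3 + t 4 = 0" using eq_w by (simp add: t_def)
    then have bound: "sqrt ((t 1)\<^sup>2 + 4 * (r 1 - 1 + 1)) + sqrt ((t 2)\<^sup>2 + 4 * (r 2 - 1 + 1))
        + sqrt ((t 3)\<^sup>2 + 4 * (r 3 - 1 + 1)) + sqrt ((t 4)\<^sup>2 + 4 * (r 4 - 1 + 1))
        \<le> sqrt (?u\<^sup>2 + 4 * (r 4 - 1 + 1)) + (r 1 - 1 + 2) + (r 2 - 1 + 2) + (r 3 - 1 + 2)"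
      using assms(3-6) by (intro sum_sqrt_le t_bds in_I) auto
    have sqrt_u: "sqrt (?u\<^sup>2 + 4 * (r 4 - 1 + 1)) = sqrt (4 * r 4 + ?u\<^sup>2)"
      by (simp add: add.commute)
    show ?thesis
      \<comment> \<open>By \<open>eq_w\<close>, the sum of the \<open>r i / w i\<close> is half the
        sum of the \<open>w i + r i / w i\<close>, which turns the factor 1/4 into 1/8.\<close>
      using bound eq_w unfolding sums sqrt_u sqrt_t[OF in_I(1)] sqrt_t[OF in_I(2)]
        sqrt_t[OF in_I(3)] sqrt_t[OF in_I(4)] of_nat_numeral
      by argo
  qed
  show ?thesis
    unfolding z_f_def
    by (rule cSup_eq_maximum) (use x_mem x_val upper in \<open>auto intro!: image_eqI[where x = x]\<close>)
qed

end
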